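(* Every left or right cancellative monoid with amenable group of units is sofic.
   Context: Sofic monoids: Let $M$ be a monoid with identity $1$. For a finite subset $K \subseteq M$ and $\epsilon > 0$, a (left) $(K,\epsilon)$-action of $M$ on a non-empty finite set $X$ is a map $M \times X \to X$, $(m,x) \mapsto m \cdot x$ (not required to be an action) such that: (1) $1 \cdot x = x$ for all $x \in X$; (2) for all $g,h \in K$, the proportion of elements $x \in X$ with $g \cdot (h \cdot x) = (gh)\cdot x$ is at least $1-\epsilon$; (3) for all $g,h \in K$ with $g \neq h$, the proportion of elements $x \in X$ with $g \cdot x = h \cdot x$ is at most $\epsilon$. The monoid $M$ is (left) sofic, or simply sofic, if for every finite $K \subseteq M$ and every $\epsilon > 0$ there exist a non-empty finite set $X$ and a $(K,\epsilon)$-action of $M$ on $X$. Amenability is that of discrete groups. *)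

theory Defs
  imports Complex_Main "HOL-Algebra.Coset"
begin

definition left_cancellative :: "('a, 'b) monoid_scheme \<Rightarrow> bool" where
  "left_cancellative M \<longleftrightarrow>
     (\<forall>a \<in> carrier M. \<forall>b \<in> carrier M. \<forall>c \<in> carrier M.
        a \<otimes>\<^bsub>M\<^esub> b = a \<otimes>\<^bsub>M\<^esub> c \<longrightarrow> b = c)"

definition right_cancellative :: "('a, 'b) monoid_scheme \<Rightarrow> bool" where
  "right_cancellative M \<longleftrightarrow>
     (\<forall>a \<in> carrier M. \<forall>b \<in> carrier M. \<forall>c \<in> carrier M.
        b \<otimes>\<^bsub>M\<^esub> a = c \<otimes>\<^bsub>M\<^esub> a \<longrightarrow> b = c)"

text \<open>Amenability of a discrete group in the sense of von Neumann: there is a left-invariant,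
  finitely additive probability measure defined on all subsets of the group. The values of
  \<open>\<mu>\<close> on sets that are not contained in the carrier are irrelevant.\<close>

definition amenable_group :: "('a, 'b) monoid_scheme \<Rightarrow> bool" where
  "amenable_group G \<longleftrightarrow> group G \<and>
     (\<exists>\<mu> :: 'a set \<Rightarrow> real.
        (\<forall>A. A \<subseteq> carrier G \<longrightarrow> 0 \<le> \<mu> A) \<and>
        \<mu> (carrier G) = 1 \<and>
        (\<forall>A B. A \<subseteq> carrier G \<longrightarrow> B \<subseteq> carrier G \<longrightarrow> A \<inter> B = {} \<longrightarrow>
           \<mu> (A \<union> B) = \<mu> A + \<mu> B) \<and>
        (\<forall>g \<in> carrier G. \<forall>A. A \<subseteq> carrier G \<longrightarrow> \<mu> (g <#\<^bsub>G\<^esub> A) = \<mu> A))"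

definition almost_action ::
  "('a, 'b) monoid_scheme \<Rightarrow> 'a set \<Rightarrow> real \<Rightarrow> 'x set \<Rightarrow> ('a \<Rightarrow> 'x \<Rightarrow> 'x) \<Rightarrow> bool" where
  "almost_action M K \<epsilon> X act \<longleftrightarrow>
     (\<forall>m \<in> carrier M. \<forall>x \<in> X. act m x \<in> X) \<and>
     (\<forall>x \<in> X. act \<one>\<^bsub>M\<^esub> x = x) \<and>
     (\<forall>g \<in> K. \<forall>h \<in> K.
        real (card {x \<in> X. act g (act h x) = act (g \<otimes>\<^bsub>M\<^esub> h) x}) / real (card X) \<ge> 1 - \<epsilon>) \<and>
     (\<forall>g \<in> K. \<forall>h \<in> K. g \<noteq> h \<longrightarrow>
        real (card {x \<in> X. act g x = act h x}) / real (card X) \<le> \<epsilon>)"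

text \<open>Almost-actions transport along bijections, so letting \<open>X\<close> range over the finite sets of
  natural numbers is the same as letting it range over all finite sets.\<close>

definition sofic :: "('a, 'b) monoid_scheme \<Rightarrow> bool" where
  "sofic M \<longleftrightarrow>
     (\<forall>K \<epsilon>. finite K \<longrightarrow> K \<subseteq> carrier M \<longrightarrow> \<epsilon> > 0 \<longrightarrow>
        (\<exists>(X :: nat set) act. finite X \<and> X \<noteq> {} \<and> almost_action M K \<epsilon> X act))"

end

theory Submission
  imports Defs
begin

text \<open>
  One-sided cancellation makes every one-sided inverse two-sided. A product in \<open>M\<close> can therefore
  be a unit only if both factors are: the non-units form a two-sided ideal.

  Let \<open>K\<close> be a finite part of \<open>M\<close>. Take a finite set \<open>F\<close> of units that is almost invariant under
  the units in \<open>K\<close> and in \<open>K K\<close>, and let \<open>Z\<close> be the finite set of the non-units in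
  \<open>(K \<union> K K) F\<close>. On many disjoint copies of \<open>F\<close> together with a single copy of \<open>Z\<close>, let
  \<open>M\<close> act by left multiplication wherever the result lies in this set. At a point \<open>y\<close> of a copy of
  \<open>F\<close> that is not near the boundary, all the products \<open>k y\<close> and \<open>g h y\<close> (with \<open>g, h, k \<in> K\<close>)
  stay in the set: those by a unit remain in the same copy of \<open>F\<close>, the others fall into \<open>Z\<close>,
  which no multiplication leaves for \<open>F\<close>. At such a point the action law holds exactly, and
  \<open>g y \<noteq> h y\<close> for \<open>g \<noteq> h\<close> because \<open>y\<close> is invertible. The other points are the boundary of \<open>F\<close>
  and \<open>Z\<close>; taking enough copies of \<open>F\<close> makes the proportion of \<open>Z\<close> negligible. Hence
  \<open>almost_action_left_multiplication\<close>.

  What remains is to produce \<open>F\<close> from an invariant mean, that is, the Folner condition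
  (\<open>amenable_imp_Folner\<close>). If it failed, some finite set \<open>T\<close> would satisfy
  \<open>\<bar>T F\<bar> \<ge> 2 \<bar>F\<bar>\<close> for all finite \<open>F\<close>. The marriage theorem, in its version for infinitely many
  finite sets, then yields two injections of the group into itself with disjoint images, each of
  which moves points by left translations from \<open>T\<close> only. Such injections preserve the mean, so the
  group would have two disjoint subsets of mean 1.
\<close>

section \<open>The marriage theorem for infinite families of finite sets\<close>

text \<open>
  Call a set of pairs a Hall relation if it satisfies the marriage condition. Since all the sets
  are finite, the marriage condition of a finite set of indices depends on finitely many pairs only,
  so intersections of nonempty chains of Hall relations are Hall relations and there is a minimal
  one. That one is already a function: if \<open>i\<close> had two partners, removing one of them would violate
  the condition at some \<open>{i} \<union> J\<close>, removing the other would violate it at some \<open>{i} \<union> L\<close>, and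
  submodularity of the cardinality of neighbourhoods would contradict the condition at
  \<open>{i} \<union> J \<union> L\<close> or at \<open>J \<inter> L\<close>.
\<close>

theorem marriage_infinite:
  fixes A :: "'i \<Rightarrow> 'b set"
  assumes fin: "\<And>i. i \<in> I \<Longrightarrow> finite (A i)"
    and hall: "\<And>J. finite J \<Longrightarrow> J \<subseteq> I \<Longrightarrow> card J \<le> card (\<Union>i\<in>J. A i)"
  shows "\<exists>f. inj_on f I \<and> (\<forall>i\<in>I. f i \<in> A i)"
proof -
  define S where "S = Sigma I A"
  define Hall where "Hall R \<longleftrightarrow> (\<forall>J. finite J \<longrightarrow> J \<subseteq> I \<longrightarrow> card J \<le> card (R `` J))" for R :: "('i \<times> 'b) set"
  \<comment> \<open>Zorn's lemma is applied to the sets of removed pairs.\<close>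
  define C where "C = {D. D \<subseteq> S \<and> Hall (S - D)}"
  have finR: "finite (R `` J)" if "R \<subseteq> S" "finite J" "J \<subseteq> I" for R J
  proof (rule finite_subset)
    show "R `` J \<subseteq> (\<Union>i\<in>J. A i)" using that unfolding S_def by blast
    show "finite (\<Union>i\<in>J. A i)" using that fin by blast
  qed
  have "C \<noteq> {}"
  proof -
    have "S `` J = (\<Union>i\<in>J. A i)" if "J \<subseteq> I" for J
      using that unfolding S_def by blast
    then have "{} \<in> C" using hall unfolding C_def Hall_def by simp
    then show ?thesis by blast
  qed
  moreover have "\<Union>c \<in> C" if ne: "c \<noteq> {}" and ch: "subset.chain C c" for c
  proof -
    have cC: "c \<subseteq> C" using ch by (simp add: subset_chain_def)
    have "card J \<le> card ((S - \<Union>c) `` J)" if J: "finite J" "J \<subseteq> I" for J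
    proof -
      have "finite (Sigma J A)" using J fin by blast
      then have "finite (\<Union>c \<inter> Sigma J A)" by blast
      then obtain d where d: "d \<in> c" "\<Union>c \<inter> Sigma J A \<subseteq> d"
        using finite_subset_Union_chain[OF _ _ ne ch] by (metis inf_le1)
      have "card J \<le> card ((S - d) `` J)"
        using d(1) cC J unfolding C_def Hall_def by blast
      also have "\<dots> \<le> card ((S - \<Union>c) `` J)"
      proof (rule card_mono)
        show "finite ((S - \<Union>c) `` J)" by (rule finR) (use J in auto)
        show "(S - d) `` J \<subseteq> (S - \<Union>c) `` J"
        proof
          fix b assume "b \<in> (S - d) `` J"
          then obtain j where j: "j \<in> J" "(j, b) \<in> S" "(j, b) \<notin> d" by blast
          then have "(j, b) \<in> Sigma J A" unfolding S_def by blast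
          then have "(j, b) \<notin> \<Union>c" using d j by blast
          then show "b \<in> (S - \<Union>c) `` J" using j by blast
        qed
      qed
      finally show ?thesis .
    qed
    then show ?thesis using cC unfolding C_def Hall_def by blast
  qed
  ultimately obtain D where D: "D \<in> C" and max: "\<And>X. X \<in> C \<Longrightarrow> D \<subseteq> X \<Longrightarrow> X = D"
    using subset_Zorn_nonempty[of C] by metis
  define R where "R = S - D"
  have RS: "R \<subseteq> S" unfolding R_def by blast
  have HR: "card J \<le> card (R `` J)" if "finite J" "J \<subseteq> I" for J
    using D that unfolding C_def Hall_def R_def by blast
  have minimal: "\<exists>J. finite J \<and> J \<subseteq> I - {i} \<and> card (R `` J \<union> (R `` {i} - {x})) \<le> card J"
    if ix: "(i, x) \<in> R" for i x
  proof -
    have "insert (i, x) D \<notin> C"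
      using max[of "insert (i, x) D"] ix unfolding R_def by blast
    moreover have "insert (i, x) D \<subseteq> S" using D ix unfolding C_def R_def by blast
    moreover have "S - insert (i, x) D = R - {(i, x)}" unfolding R_def by blast
    ultimately have "\<not> Hall (R - {(i, x)})" unfolding C_def by simp
    then obtain J where J: "finite J" "J \<subseteq> I" "card ((R - {(i, x)}) `` J) < card J"
      unfolding Hall_def by (auto simp: not_le)
    have iJ: "i \<in> J"
    proof (rule ccontr)
      assume "i \<notin> J"
      then have "(R - {(i, x)}) `` J = R `` J" by blast
      with HR[OF J(1,2)] J(3) show False by simp
    qed
    have "(R - {(i, x)}) `` J = R `` (J - {i}) \<union> (R `` {i} - {x})"
      using iJ by auto
    then have "card (R `` (J - {i}) \<union> (R `` {i} - {x})) \<le> card (J - {i})"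
      using J iJ by simp
    then show ?thesis using J by blast
  qed
  have single: "x = y" if ix: "(i, x) \<in> R" and iy: "(i, y) \<in> R" for i x y
  proof (rule ccontr)
    assume xy: "x \<noteq> y"
    have iI: "i \<in> I" using ix RS unfolding S_def by blast
    obtain J where J: "finite J" "J \<subseteq> I - {i}" "card (R `` J \<union> (R `` {i} - {x})) \<le> card J"
      using minimal[OF ix] by blast
    obtain L where L: "finite L" "L \<subseteq> I - {i}" "card (R `` L \<union> (R `` {i} - {y})) \<le> card L"
      using minimal[OF iy] by blast
    define P where "P = R `` J \<union> (R `` {i} - {x})"
    define Q where "Q = R `` L \<union> (R `` {i} - {y})"
    have finI: "finite (R `` {i})" by (rule finR) (use RS iI in auto)
    have finP: "finite P" unfolding P_def using finR[OF RS, of J] J finI by auto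
    have finQ: "finite Q" unfolding Q_def using finR[OF RS, of L] L finI by auto
    have "P \<union> Q = R `` insert i (J \<union> L)"
      unfolding P_def Q_def using xy ix iy by auto
    then have "card (insert i (J \<union> L)) \<le> card (P \<union> Q)"
      using HR[of "insert i (J \<union> L)"] J L iI by auto
    moreover have "i \<notin> J \<union> L" "finite (J \<union> L)" using J L by auto
    ultimately have u: "Suc (card (J \<union> L)) \<le> card (P \<union> Q)" by simp
    have "card (J \<inter> L) \<le> card (R `` (J \<inter> L))"
      using J L by (intro HR) auto
    also have "\<dots> \<le> card (P \<inter> Q)"
      by (rule card_mono) (use finP in \<open>auto simp: P_def Q_def\<close>)
    finally have "card (J \<inter> L) \<le> card (P \<inter> Q)" .
    with u have "Suc (card J + card L) \<le> card P + card Q"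
      using card_Un_Int[OF J(1) L(1)] card_Un_Int[OF finP finQ] by linarith
    with J(3) L(3) show False unfolding P_def Q_def by linarith
  qed
  have "\<exists>x. (i, x) \<in> R" if "i \<in> I" for i
  proof (rule ccontr)
    assume "\<nexists>x. (i, x) \<in> R"
    then have "R `` {i} = {}" by blast
    then show False using HR[of "{i}"] that by simp
  qed
  then obtain f where f: "\<And>i. i \<in> I \<Longrightarrow> (i, f i) \<in> R" by metis
  have "inj_on f I"
  proof (rule inj_onI, rule ccontr)
    fix i j assume ij: "i \<in> I" "j \<in> I" "f i = f j" "i \<noteq> j"
    have "R `` {i, j} \<subseteq> {f i}" using f[OF ij(1)] f[OF ij(2)] single ij(3) by auto
    then have "card (R `` {i, j}) \<le> 1" using card_mono[of "{f i}"] by auto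
    moreover have "card {i, j} = 2" using ij by simp
    ultimately show False using HR[of "{i, j}"] ij by simp
  qed
  moreover have "f i \<in> A i" if "i \<in> I" for i
    using f[OF that] RS unfolding S_def by blast
  ultimately show ?thesis by blast
qed

section \<open>Folner sets from an invariant mean\<close>

text \<open>
  The set splits into finitely many pieces according to the translation used, and finite additivity
  adds up the pieces of the image because the map is injective.
\<close>

lemma piecewise_translation_preserves_mean:
  fixes G (structure) and \<mu> :: "'a set \<Rightarrow> real"
  assumes G: "group G"
    and add: "\<And>A B. A \<subseteq> carrier G \<Longrightarrow> B \<subseteq> carrier G \<Longrightarrow> A \<inter> B = {} \<Longrightarrow> \<mu> (A \<union> B) = \<mu> A + \<mu> B"
    and inv: "\<And>g A. g \<in> carrier G \<Longrightarrow> A \<subseteq> carrier G \<Longrightarrow> \<mu> (g <# A) = \<mu> A"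
    and "finite T" "T \<subseteq> carrier G" "A \<subseteq> carrier G" "inj_on f A" "\<And>x. x \<in> A \<Longrightarrow> \<exists>t\<in>T. f x = t \<otimes> x"
  shows "\<mu> (f ` A) = \<mu> A"
  using assms(4-8)
proof (induction T arbitrary: A rule: finite_induct)
  case empty
  then have "A = {}" by auto
  then show ?case by simp
next
  case (insert t T)
  interpret group G by (rule G)
  define B where "B = {x \<in> A. f x = t \<otimes> x}"
  have sub: "B \<subseteq> carrier G" "A - B \<subseteq> carrier G" using insert.prems unfolding B_def by auto
  have fB: "f ` B = t <# B" unfolding B_def l_coset_def by force
  have maps: "f x \<in> carrier G" if "x \<in> A" for x
    using insert.prems(1,2) insert.prems(4)[OF that] that by (metis m_closed subsetD)
  have IH: "\<mu> (f ` (A - B)) = \<mu> (A - B)"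
  proof (rule insert.IH)
    show "inj_on f (A - B)" using insert.prems(3) by (rule inj_on_subset) auto
    show "\<exists>s\<in>T. f x = s \<otimes> x" if "x \<in> A - B" for x
      using insert.prems(4)[of x] that unfolding B_def by auto
  qed (use insert.prems sub in auto)
  have disj: "f ` B \<inter> f ` (A - B) = {}"
    using insert.prems(3) unfolding B_def inj_on_def by auto
  have "f ` B \<subseteq> carrier G" "f ` (A - B) \<subseteq> carrier G"
    using maps unfolding B_def image_subset_iff by blast+
  then have "\<mu> (f ` B \<union> f ` (A - B)) = \<mu> (f ` B) + \<mu> (f ` (A - B))"
    using disj by (intro add)
  moreover have "\<mu> (B \<union> (A - B)) = \<mu> B + \<mu> (A - B)" by (rule add[OF sub]) auto
  moreover have "B \<union> (A - B) = A" unfolding B_def by auto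
  ultimately show ?case
    using IH inv[of t B] fB sub insert.prems(1) image_Un[of f B "A - B"] by simp
qed

lemma (in group) finite_set_mult:
  "finite A \<Longrightarrow> finite B \<Longrightarrow> finite (A <#> B)"
  unfolding set_mult_def by auto

text \<open>
  A set of translations that doubles all finite sets satisfies the marriage condition twice over:
  every element finds two partners among its translates, all of them distinct.
\<close>

lemma amenable_not_doubling:
  fixes G (structure)
  assumes am: "amenable_group G" and T: "finite T" "T \<subseteq> carrier G"
    and doubling: "\<And>F. finite F \<Longrightarrow> F \<subseteq> carrier G \<Longrightarrow> 2 * card F \<le> card (T <#> F)"
  shows False
proof -
  interpret group G using am unfolding amenable_group_def by blast
  obtain \<mu> :: "'a set \<Rightarrow> real" where \<mu>:
    "\<forall>A. A \<subseteq> carrier G \<longrightarrow> 0 \<le> \<mu> A" "\<mu> (carrier G) = 1"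
    "\<forall>A B. A \<subseteq> carrier G \<longrightarrow> B \<subseteq> carrier G \<longrightarrow> A \<inter> B = {} \<longrightarrow> \<mu> (A \<union> B) = \<mu> A + \<mu> B"
    "\<forall>g \<in> carrier G. \<forall>A. A \<subseteq> carrier G \<longrightarrow> \<mu> (g <# A) = \<mu> A"
    using am unfolding amenable_group_def by (elim conjE exE) (rule that; assumption)
  have pos: "0 \<le> \<mu> A" if "A \<subseteq> carrier G" for A using \<mu>(1) that by simp
  note one = \<mu>(2)
  have add: "\<mu> (A \<union> B) = \<mu> A + \<mu> B"
    if "A \<subseteq> carrier G" "B \<subseteq> carrier G" "A \<inter> B = {}" for A B using \<mu>(3) that by simp
  have inv: "\<mu> (g <# A) = \<mu> A" if "g \<in> carrier G" "A \<subseteq> carrier G" for g A using \<mu>(4) that by simp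
  let ?I = "carrier G \<times> (UNIV :: bool set)"
  have "\<exists>f. inj_on f ?I \<and> (\<forall>i\<in>?I. f i \<in> T <#> {fst i})"
  proof (rule marriage_infinite)
    show "finite (T <#> {fst i})" for i :: "'a \<times> bool" using T by (simp add: finite_set_mult)
    fix J assume J: "finite J" "J \<subseteq> ?I"
    have "card J \<le> card (fst ` J \<times> (UNIV :: bool set))"
      by (rule card_mono) (use J in simp, force)
    also have "\<dots> = 2 * card (fst ` J)" by (simp add: card_cartesian_product)
    also have "\<dots> \<le> card (T <#> fst ` J)" using J by (intro doubling) auto
    also have "T <#> fst ` J = (\<Union>i\<in>J. T <#> {fst i})" unfolding set_mult_def by auto
    finally show "card J \<le> card (\<Union>i\<in>J. T <#> {fst i})" .
  qed
  then obtain f where f: "inj_on f ?I" "\<And>x b. x \<in> carrier G \<Longrightarrow> \<exists>t\<in>T. f (x, b) = t \<otimes> x"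
    unfolding set_mult_def by fastforce
  define D where "D b = (\<lambda>x. f (x, b)) ` carrier G" for b
  have D1: "\<mu> (D b) = 1" for b
    unfolding D_def one[symmetric]
    by (rule piecewise_translation_preserves_mean[OF is_group add inv T subset_refl])
       (use f in \<open>auto simp: inj_on_def\<close>)
  have Dsub: "D b \<subseteq> carrier G" for b
    unfolding D_def image_subset_iff using f(2) T(2) by (metis m_closed subsetD)
  have "D True \<inter> D False = {}"
    using f(1) unfolding D_def inj_on_def by auto
  then have two: "\<mu> (D True \<union> D False) = 2" using add[OF Dsub Dsub] D1 by simp
  have "\<mu> ((D True \<union> D False) \<union> (carrier G - (D True \<union> D False))) =
      \<mu> (D True \<union> D False) + \<mu> (carrier G - (D True \<union> D False))"
    by (rule add) (use Dsub in auto)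
  moreover have "(D True \<union> D False) \<union> (carrier G - (D True \<union> D False)) = carrier G"
    using Dsub by blast
  moreover have "0 \<le> \<mu> (carrier G - (D True \<union> D False))" by (rule pos) auto
  ultimately show False using one two by simp
qed

text \<open>
  Translating \<open>n\<close> times by \<open>S\<close> multiplies cardinalities by at least \<open>(1 + \<delta>)\<^sup>n\<close>, so a large
  enough power of \<open>S\<close> serves as \<open>T\<close>, uniformly in \<open>F\<close>.
\<close>

lemma (in group) expanding_imp_doubling:
  assumes S: "finite S" "S \<subseteq> carrier G" and \<delta>: "0 < (\<delta>::real)"
    and grow: "\<And>F. finite F \<Longrightarrow> F \<subseteq> carrier G \<Longrightarrow> (1 + \<delta>) * real (card F) \<le> real (card (S <#> F))"
  shows "\<exists>T. finite T \<and> T \<subseteq> carrier G \<and>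
    (\<forall>F. finite F \<longrightarrow> F \<subseteq> carrier G \<longrightarrow> 2 * card F \<le> card (T <#> F))"
proof -
  have pow: "\<exists>T. finite T \<and> T \<subseteq> carrier G \<and>
      (\<forall>F. finite F \<longrightarrow> F \<subseteq> carrier G \<longrightarrow> (1 + \<delta>) ^ n * real (card F) \<le> real (card (T <#> F)))" for n
  proof (induction n)
    case 0
    have "{\<one>} <#> F = F" if "F \<subseteq> carrier G" for F
      using that unfolding set_mult_def by force
    then show ?case by (intro exI[of _ "{\<one>}"]) auto
  next
    case (Suc n)
    then obtain T where T: "finite T" "T \<subseteq> carrier G"
      and gT: "\<And>F. finite F \<Longrightarrow> F \<subseteq> carrier G \<Longrightarrow> (1 + \<delta>) ^ n * real (card F) \<le> real (card (T <#> F))"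
      by blast
    have "(1 + \<delta>) ^ Suc n * real (card F) \<le> real (card ((S <#> T) <#> F))"
      if F: "finite F" "F \<subseteq> carrier G" for F
    proof -
      have "(1 + \<delta>) ^ Suc n * real (card F) = (1 + \<delta>) * ((1 + \<delta>) ^ n * real (card F))" by simp
      also have "\<dots> \<le> (1 + \<delta>) * real (card (T <#> F))"
        using gT[OF F] \<delta> by (intro mult_left_mono) auto
      also have "\<dots> \<le> real (card (S <#> (T <#> F)))"
        using F T by (intro grow) (auto simp: finite_set_mult set_mult_closed)
      also have "S <#> (T <#> F) = (S <#> T) <#> F"
        using S T F by (simp add: set_mult_assoc)
      finally show ?thesis .
    qed
    then show ?case using S T
      by (intro exI[of _ "S <#> T"]) (auto simp: finite_set_mult set_mult_closed)
  qed
  obtain n where n: "2 < (1 + \<delta>) ^ n" using real_arch_pow[of "1 + \<delta>" 2] \<delta> by auto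
  obtain T where T: "finite T" "T \<subseteq> carrier G"
    and gT: "\<And>F. finite F \<Longrightarrow> F \<subseteq> carrier G \<Longrightarrow> (1 + \<delta>) ^ n * real (card F) \<le> real (card (T <#> F))"
    using pow[of n] by blast
  have "2 * card F \<le> card (T <#> F)" if F: "finite F" "F \<subseteq> carrier G" for F
  proof -
    have "2 * real (card F) \<le> (1 + \<delta>) ^ n * real (card F)"
      using n by (intro mult_right_mono) auto
    also have "\<dots> \<le> real (card (T <#> F))" by (rule gT[OF F])
    finally show ?thesis by linarith
  qed
  with T show ?thesis by blast
qed

text \<open>
  If more than an \<open>\<epsilon>\<close>-fraction of every \<open>F\<close> is carried out of \<open>F\<close> by some element of \<open>L\<close>, then
  \<open>L F\<close> has at least \<open>\<epsilon> \<bar>F\<bar> / \<bar>L\<bar>\<close> elements outside \<open>F\<close>, since each of them is reached from at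
  most \<open>\<bar>L\<bar>\<close> points of \<open>F\<close>. So \<open>L \<union> {\<one>}\<close> is expanding, which an invariant mean forbids.
\<close>

theorem amenable_imp_Folner:
  fixes G (structure)
  assumes am: "amenable_group G" and L: "finite L" "L \<subseteq> carrier G" and \<epsilon>: "0 < (\<epsilon>::real)"
  shows "\<exists>F. finite F \<and> F \<noteq> {} \<and> F \<subseteq> carrier G \<and>
    (1 - \<epsilon>) * real (card F) \<le> real (card {y \<in> F. \<forall>k\<in>L. k \<otimes> y \<in> F})"
proof (rule ccontr)
  assume neg: "\<not> ?thesis"
  interpret group G using am unfolding amenable_group_def by blast
  \<comment> \<open>The denominator is \<open>\<bar>L\<bar> + 1\<close> so that \<open>L = {}\<close> needs no separate treatment.\<close>
  define \<delta> where "\<delta> = \<epsilon> / real (Suc (card L))"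
  have \<delta>: "0 < \<delta>" using \<epsilon> unfolding \<delta>_def by simp
  define S where "S = insert \<one> L"
  have S: "finite S" "S \<subseteq> carrier G" using L unfolding S_def by auto
  have "(1 + \<delta>) * real (card F) \<le> real (card (S <#> F))" if F: "finite F" "F \<subseteq> carrier G" for F
  proof (cases "F = {}")
    case False
    define Good where "Good = {y \<in> F. \<forall>k\<in>L. k \<otimes> y \<in> F}"
    define E where "E = (S <#> F) - F"
    have FS: "F \<subseteq> S <#> F" using F unfolding S_def set_mult_def by force
    have finS: "finite (S <#> F)" by (rule finite_set_mult[OF S(1) F(1)])
    then have finE: "finite E" unfolding E_def by blast
    have "F - Good \<subseteq> (\<lambda>(k, z). inv k \<otimes> z) ` (L \<times> E)"
    proof
      fix y assume "y \<in> F - Good"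
      then obtain k where k: "y \<in> F" "k \<in> L" "k \<otimes> y \<notin> F" unfolding Good_def by blast
      then have "k \<otimes> y \<in> E" unfolding E_def S_def set_mult_def by blast
      moreover have "y = inv k \<otimes> (k \<otimes> y)"
        using k F L by (metis inv_solve_left m_closed subsetD)
      ultimately show "y \<in> (\<lambda>(k, z). inv k \<otimes> z) ` (L \<times> E)" using k by force
    qed
    then have "card (F - Good) \<le> card (L \<times> E)"
      by (rule surj_card_le[rotated]) (use L(1) finE in simp)
    then have "card (F - Good) \<le> card L * card E" by (simp add: card_cartesian_product)
    moreover have "card F = card Good + card (F - Good)"
      using F(1) card_Diff_subset[of Good F] card_mono[of F Good] unfolding Good_def by fastforce
    ultimately have "card F \<le> card Good + card L * card E" by linarith
    then have "real (card F) \<le> real (card Good) + real (card L) * real (card E)"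
      by (metis of_nat_add of_nat_le_iff of_nat_mult)
    moreover have "real (card Good) < (1 - \<epsilon>) * real (card F)"
      using neg F False unfolding Good_def by (meson not_le)
    ultimately have "\<epsilon> * real (card F) \<le> real (card L) * real (card E)"
      by (simp add: algebra_simps)
    also have "\<dots> \<le> real (Suc (card L)) * real (card E)" by (intro mult_right_mono) auto
    finally have "\<delta> * real (card F) \<le> real (card E)"
      unfolding \<delta>_def by (simp add: field_simps)
    moreover have "card (S <#> F) = card F + card E"
      unfolding E_def using card_Diff_subset[OF F(1) FS] card_mono[OF finS FS] by simp
    ultimately show ?thesis by (simp add: algebra_simps)
  qed simp
  from expanding_imp_doubling[OF S \<delta> this] obtain T where
    "finite T" "T \<subseteq> carrier G"
    "\<And>F. finite F \<Longrightarrow> F \<subseteq> carrier G \<Longrightarrow> 2 * card F \<le> card (T <#> F)"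
    by blast
  then show False using amenable_not_doubling[OF am] by blast
qed

section \<open>Almost-actions of monoids whose non-units form an ideal\<close>

text \<open>
  If \<open>a b = \<one>\<close>, then \<open>a (b a) = a\<close> and \<open>(b a) b = b\<close>, and cancelling on either side gives
  \<open>b a = \<one>\<close>. Both factors of a unit are one-sided invertible, hence units.
\<close>

lemma (in monoid) cancellative_unit_factors:
  assumes canc: "left_cancellative G \<or> right_cancellative G"
    and x: "x \<in> carrier G" and y: "y \<in> carrier G" and xy: "x \<otimes> y \<in> Units G"
  shows "x \<in> Units G \<and> y \<in> Units G"
proof -
  have two_sided: "b \<otimes> a = \<one>" if a: "a \<in> carrier G" and b: "b \<in> carrier G" and ab: "a \<otimes> b = \<one>" for a b
    using canc
  proof
    assume "left_cancellative G"
    moreover have "a \<otimes> (b \<otimes> a) = a \<otimes> \<one>" using a b ab by (metis l_one m_assoc r_one)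
    ultimately show ?thesis using a b unfolding left_cancellative_def by (meson m_closed one_closed)
  next
    assume "right_cancellative G"
    moreover have "(b \<otimes> a) \<otimes> b = \<one> \<otimes> b" using a b ab by (metis l_one m_assoc r_one)
    ultimately show ?thesis using a b unfolding right_cancellative_def by (meson m_closed one_closed)
  qed
  define u where "u = inv (x \<otimes> y)"
  have u: "u \<in> carrier G" using xy unfolding u_def by simp
  have r: "x \<otimes> (y \<otimes> u) = \<one>" using xy x y u unfolding u_def by (metis Units_r_inv m_assoc)
  have l: "(u \<otimes> x) \<otimes> y = \<one>" using xy x y u unfolding u_def by (metis Units_l_inv m_assoc)
  have "x \<in> Units G" using r two_sided[OF x _ r] x y u unfolding Units_def by blast
  moreover have "y \<in> Units G" using l two_sided[OF _ y l] x y u unfolding Units_def by blast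
  ultimately show ?thesis by blast
qed

text \<open>
  A point \<open>(a, i)\<close> of \<open>X\<close> is the element \<open>a\<close> in the copy numbered \<open>i\<close>. There are \<open>N\<close> copies of
  the set \<open>F\<close> of units, and one of the set \<open>Z\<close> of non-units, so a product that is not a unit is
  put into copy 0. This is compatible with multiplying in two steps: if \<open>g (h a)\<close> is a unit, then
  so is \<open>h a\<close>, and the copy number was not lost on the way.
\<close>

theorem (in monoid) almost_action_left_multiplication:
  assumes ideal: "\<And>x y. x \<in> carrier G \<Longrightarrow> y \<in> carrier G \<Longrightarrow> x \<otimes> y \<in> Units G \<Longrightarrow> x \<in> Units G \<and> y \<in> Units G"
    and am: "amenable_group (units_of G)"
    and K: "finite K" "K \<subseteq> carrier G" and \<epsilon>: "0 < (\<epsilon>::real)"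
  shows "\<exists>(X :: ('a \<times> nat) set) act. finite X \<and> X \<noteq> {} \<and> almost_action G K \<epsilon> X act"
proof -
  define K2 where "K2 = K \<union> (\<lambda>(g, h). g \<otimes> h) ` (K \<times> K)"
  have K2: "finite K2" "K2 \<subseteq> carrier G" using K unfolding K2_def by auto
  obtain F where F: "finite F" "F \<noteq> {}" "F \<subseteq> Units G"
    and folner: "(1 - \<epsilon> / 2) * real (card F) \<le> real (card {y \<in> F. \<forall>k \<in> K2 \<inter> Units G. k \<otimes> y \<in> F})"
    using amenable_imp_Folner[OF am, of "K2 \<inter> Units G" "\<epsilon> / 2"] K2 \<epsilon>
    by (auto simp: units_of_carrier units_of_mult)
  define Good where "Good = {y \<in> F. \<forall>k \<in> K2 \<inter> Units G. k \<otimes> y \<in> F}"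
  define Z where "Z = (\<lambda>(k, y). k \<otimes> y) ` (K2 \<times> F) - Units G"
  have Z: "finite Z" "Z \<inter> Units G = {}" unfolding Z_def using K2 F by auto
  \<comment> \<open>Enough copies for \<open>Z\<close> to take up at most half of the permitted error; the boundary of \<open>F\<close>
    takes up the other half.\<close>
  obtain N where N: "real (card Z) / (\<epsilon> / 2) < real N" using reals_Archimedean2 by blast
  have N0: "0 < N"
  proof -
    have "0 \<le> real (card Z) / (\<epsilon> / 2)" using \<epsilon> by simp
    with N show ?thesis by linarith
  qed
  define X where "X = F \<times> {..<N} \<union> Z \<times> {0}"
  define P where "P m x = (m \<otimes> fst x, if m \<otimes> fst x \<in> Units G then snd x else (0::nat))" for m and x :: "'a \<times> nat"
  define act where "act m x = (if P m x \<in> X then P m x else x)" for m x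
  define GX where "GX = Good \<times> {..<N}"
  have finX: "finite X" and neX: "X \<noteq> {}" unfolding X_def using F Z N0 by auto
  have GXsub: "GX \<subseteq> X" unfolding GX_def Good_def X_def by auto
  have cX: "card X = card F * N + card Z"
    unfolding X_def using F Z by (subst card_Un_disjoint) (auto simp: card_cartesian_product)
  have cXpos: "0 < real (card X)" using finX neX by (simp add: card_gt_0_iff)
  have large: "(1 - \<epsilon>) * real (card X) \<le> real (card GX)"
  proof -
    have "real (card Z) \<le> \<epsilon> / 2 * real N" using N \<epsilon> by (simp add: field_simps)
    also have "\<dots> \<le> \<epsilon> / 2 * (real (card F) * real N)"
    proof -
      have "1 \<le> card F" using F by (simp add: Suc_le_eq card_gt_0_iff)
      then have "1 * real N \<le> real (card F) * real N" by (intro mult_right_mono) auto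
      then show ?thesis using \<epsilon> by (intro mult_left_mono) auto
    qed
    finally have z: "real (card Z) \<le> \<epsilon> / 2 * (real (card F) * real N)" .
    have g: "(1 - \<epsilon> / 2) * (real (card F) * real N) \<le> real (card Good) * real N"
      using mult_right_mono[OF folner, of "real N"] unfolding Good_def by (simp add: mult.assoc)
    have "0 \<le> \<epsilon> * real (card Z)" using \<epsilon> by simp
    moreover have "(1 - \<epsilon>) * real (card X) =
        (1 - \<epsilon> / 2) * (real (card F) * real N) - \<epsilon> / 2 * (real (card F) * real N)
        + real (card Z) - \<epsilon> * real (card Z)"
      unfolding cX by (simp add: algebra_simps)
    moreover have "real (card GX) = real (card Good) * real N"
      unfolding GX_def by (simp add: card_cartesian_product)
    ultimately show ?thesis using z g by linarith
  qed
  have GXD: "fst x \<in> Units G \<and> fst x \<in> carrier G \<and> fst x \<in> F \<and> snd x < N" if "x \<in> GX" for x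
    using that F(3) unfolding GX_def Good_def by (auto intro!: Units_closed)
  have PX: "P k x \<in> X" if k: "k \<in> K2" and x: "x \<in> GX" for k x
  proof (cases "k \<otimes> fst x \<in> Units G")
    case True
    then have "k \<in> Units G" using ideal GXD[OF x] K2 k by blast
    then have "k \<otimes> fst x \<in> F" using x k unfolding GX_def Good_def by auto
    then show ?thesis using True GXD[OF x] unfolding P_def X_def by auto
  next
    case False
    then have "k \<otimes> fst x \<in> Z" using k GXD[OF x] unfolding Z_def by force
    then show ?thesis using False unfolding P_def X_def by simp
  qed
  have actP: "act k x = P k x" if "k \<in> K2" "x \<in> GX" for k x
    using PX[OF that] unfolding act_def by simp
  have law: "act g (act h x) = act (g \<otimes> h) x" if g: "g \<in> K" and h: "h \<in> K" and x: "x \<in> GX" for g h x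
  proof -
    have c: "g \<in> carrier G" "h \<in> carrier G" using g h K by auto
    have gh: "g \<otimes> h \<in> K2" "h \<in> K2" using g h unfolding K2_def by auto
    have "P g (P h x) = P (g \<otimes> h) x"
      using ideal[of g "h \<otimes> fst x"] c GXD[OF x] unfolding P_def by (auto simp: m_assoc)
    then show ?thesis
      using actP[OF gh(2) x] actP[OF gh(1) x] PX[OF gh(1) x] unfolding act_def[of g] by simp
  qed
  have free: "g = h" if g: "g \<in> K" and h: "h \<in> K" and x: "x \<in> GX" and eq: "act g x = act h x" for g h x
  proof -
    have "g \<in> K2" "h \<in> K2" using g h unfolding K2_def by auto
    then have "g \<otimes> fst x = h \<otimes> fst x" using eq actP x unfolding P_def by simp
    then have "(g \<otimes> fst x) \<otimes> inv (fst x) = (h \<otimes> fst x) \<otimes> inv (fst x)" by simp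
    then show ?thesis using GXD[OF x] g h K by (simp add: m_assoc subset_iff)
  qed
  have "almost_action G K \<epsilon> X act"
    unfolding almost_action_def
  proof (intro conjI ballI impI)
    show "act m x \<in> X" if "x \<in> X" for m x using that unfolding act_def by simp
  next
    fix x assume x: "x \<in> X"
    have "F \<subseteq> carrier G" using F(3) Units_closed by blast
    then have "fst x \<in> carrier G" using x K2(2) unfolding X_def Z_def by (auto intro!: m_closed)
    moreover have "snd x = 0" if "fst x \<notin> Units G" using x that F(3) unfolding X_def by auto
    ultimately have "P \<one> x = x" unfolding P_def by (auto intro: prod_eqI)
    then show "act \<one> x = x" unfolding act_def by simp
  next
    fix g h assume gh: "g \<in> K" "h \<in> K"
    have "card GX \<le> card {x \<in> X. act g (act h x) = act (g \<otimes> h) x}"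
      using GXsub law gh finX by (intro card_mono) auto
    then show "1 - \<epsilon> \<le> real (card {x \<in> X. act g (act h x) = act (g \<otimes> h) x}) / real (card X)"
      using large cXpos by (simp add: pos_le_divide_eq)
  next
    fix g h assume gh: "g \<in> K" "h \<in> K" "g \<noteq> h"
    have "card {x \<in> X. act g x = act h x} \<le> card (X - GX)"
      using free gh finX by (intro card_mono) auto
    also have "\<dots> = card X - card GX"
      using GXsub finX by (simp add: card_Diff_subset finite_subset)
    finally have "real (card {x \<in> X. act g x = act h x}) \<le> real (card X) - real (card GX)"
      using card_mono[OF finX GXsub] by linarith
    also have "\<dots> \<le> \<epsilon> * real (card X)" using large by (simp add: algebra_simps)
    finally show "real (card {x \<in> X. act g x = act h x}) / real (card X) \<le> \<epsilon>"
      using cXpos by (simp add: pos_divide_le_eq)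
  qed
  with finX neX show ?thesis by blast
qed

lemma almost_action_transport:
  assumes mon: "monoid M" and K: "K \<subseteq> carrier M"
    and act: "almost_action M K \<epsilon> X act" and f: "bij_betw f X Y"
  shows "almost_action M K \<epsilon> Y (\<lambda>m y. f (act m (inv_into X f y)))"
proof -
  interpret monoid M by (rule mon)
  have inj: "inj_on f X" and Y: "Y = f ` X" using f by (auto simp: bij_betw_def)
  have cXY: "card Y = card X" unfolding Y using inj by (rule card_image)
  have cl: "act m x \<in> X" if "m \<in> carrier M" "x \<in> X" for m x
    using act that unfolding almost_action_def by blast
  have cards: "card {y \<in> Y. Q (inv_into X f y)} = card {x \<in> X. Q x}" for Q
  proof -
    have "{y \<in> Y. Q (inv_into X f y)} = f ` {x \<in> X. Q x}"
      unfolding Y using inj by (auto simp: inv_into_f_f)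
    then show ?thesis using card_image inj by (metis (no_types, lifting) inj_on_subset mem_Collect_eq subsetI)
  qed
  have inX: "inv_into X f y \<in> X" if "y \<in> Y" for y using that unfolding Y by (rule inv_into_into)
  have 1: "{y \<in> Y. f (act g (inv_into X f (f (act h (inv_into X f y))))) = f (act (g \<otimes>\<^bsub>M\<^esub> h) (inv_into X f y))} =
      {y \<in> Y. act g (act h (inv_into X f y)) = act (g \<otimes>\<^bsub>M\<^esub> h) (inv_into X f y)}"
    if "g \<in> K" "h \<in> K" for g h
  proof -
    have c: "g \<in> carrier M" "h \<in> carrier M" using that K by auto
    show ?thesis
      using c by (auto simp: inX cl inv_into_f_f[OF inj] inj_on_eq_iff[OF inj])
  qed
  have 2: "{y \<in> Y. f (act g (inv_into X f y)) = f (act h (inv_into X f y))} =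
      {y \<in> Y. act g (inv_into X f y) = act h (inv_into X f y)}"
    if "g \<in> K" "h \<in> K" for g h
  proof -
    have c: "g \<in> carrier M" "h \<in> carrier M" using that K by auto
    show ?thesis using c by (auto simp: inX cl inj_on_eq_iff[OF inj])
  qed
  show ?thesis
    unfolding almost_action_def
  proof (intro conjI ballI impI)
    show "f (act m (inv_into X f y)) \<in> Y" if "m \<in> carrier M" "y \<in> Y" for m y
      using cl[OF that(1) inX[OF that(2)]] unfolding Y by blast
    show "f (act \<one>\<^bsub>M\<^esub> (inv_into X f y)) = y" if "y \<in> Y" for y
      using act inX[OF that] that unfolding almost_action_def Y by (simp add: f_inv_into_f)
  next
    fix g h assume gh: "g \<in> K" "h \<in> K"
    show "1 - \<epsilon> \<le> real (card {y \<in> Y. f (act g (inv_into X f (f (act h (inv_into X f y))))) =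
        f (act (g \<otimes>\<^bsub>M\<^esub> h) (inv_into X f y))}) / real (card Y)"
      unfolding 1[OF gh] cXY cards[of "\<lambda>x. act g (act h x) = act (g \<otimes>\<^bsub>M\<^esub> h) x"]
      using act gh unfolding almost_action_def by blast
  next
    fix g h assume gh: "g \<in> K" "h \<in> K" "g \<noteq> h"
    show "real (card {y \<in> Y. f (act g (inv_into X f y)) = f (act h (inv_into X f y))}) / real (card Y) \<le> \<epsilon>"
      unfolding 2[OF gh(1,2)] cXY cards[of "\<lambda>x. act g x = act h x"]
      using act gh unfolding almost_action_def by blast
  qed
qed

theorem corollary3p3:
  fixes M (structure)
  assumes "monoid M"
    and "left_cancellative M \<or> right_cancellative M"
    and "amenable_group (units_of M)"
  shows "sofic M"
  unfolding sofic_def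
proof (intro allI impI)
  interpret monoid M by (rule assms(1))
  fix K and \<epsilon> :: real assume K: "finite K" "K \<subseteq> carrier M" and \<epsilon>: "0 < \<epsilon>"
  obtain X :: "('a \<times> nat) set" and act where X: "finite X" "X \<noteq> {}" and act: "almost_action M K \<epsilon> X act"
    using almost_action_left_multiplication[OF cancellative_unit_factors[OF assms(2)] assms(3) K \<epsilon>] by blast
  obtain f where f: "bij_betw f X {0..<card X}" using ex_bij_betw_finite_nat[OF X(1)] by blast
  have "{0..<card X} \<noteq> {}" using X by (simp add: card_gt_0_iff)
  then show "\<exists>(Y :: nat set) act. finite Y \<and> Y \<noteq> {} \<and> almost_action M K \<epsilon> Y act"
    using almost_action_transport[OF assms(1) K(2) act f] by blast
qed

end
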